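(* Let $(\mathbb{R}^d,\gamma)$ be a generalized Minkowski space (i.e., $\gamma:\mathbb{R}^d\to\mathbb{R}$ is a gauge) and let $\varepsilon\geq 0$. If $\varepsilon$-Birkhoff orthogonality is a symmetric relation (i.e., for all $x,y\in\mathbb{R}^d$, $x\perp_B^\varepsilon y$ implies $y\perp_B^\varepsilon x$), then $\varepsilon=0$ and $\gamma$ is a norm.
   Context: A gauge is a function $\gamma:\mathbb{R}^d\to\mathbb{R}$ such that $\gamma(x)\geq 0$ for all $x$, $\gamma(x)=0$ implies $x=0$, $\gamma(\lambda x)=\lambda\gamma(x)$ for all $\lambda>0$, and $\gamma(x+y)\leq\gamma(x)+\gamma(y)$ (it need not be symmetric). For $\varepsilon\ge 0$, $x$ is $\varepsilon$-Birkhoff orthogonal to $y$, written $x\perp_B^\varepsilon y$, if $\gamma(x)\leq\gamma(x+\lambda y)+\varepsilon$ for all $\lambda\in\mathbb{R}$.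
   Formalization: The dimension is assumed to satisfy d ≥ 2; for d = 1 the claim is false: γ(x) = max(x, −2x) is a gauge and not a norm, but its Birkhoff orthogonality (ε = 0) holds only when x = 0 or y = 0 and so is symmetric. *)

theory Defs
  imports "HOL-Analysis.Analysis"
begin

(* A gauge in the sense of convex geometry: an asymmetric norm.  It is unrelated to the
   constant gauge of Henstock-Kurzweil integration. *)
definition is_gauge :: "('a::real_vector \<Rightarrow> real) \<Rightarrow> bool" where
  "is_gauge \<gamma> \<longleftrightarrow>
     (\<forall>x. \<gamma> x \<ge> 0) \<and>
     (\<forall>x. \<gamma> x = 0 \<longrightarrow> x = 0) \<and>
     (\<forall>x. \<forall>c>0. \<gamma> (c *\<^sub>R x) = c * \<gamma> x) \<and>
     (\<forall>x y. \<gamma> (x + y) \<le> \<gamma> x + \<gamma> y)"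

(* A predicate on functions, because the library has norms only as operations of type classes. *)
definition is_norm :: "('a::real_vector \<Rightarrow> real) \<Rightarrow> bool" where
  "is_norm \<gamma> \<longleftrightarrow>
     (\<forall>x. \<gamma> x \<ge> 0) \<and>
     (\<forall>x. \<gamma> x = 0 \<longleftrightarrow> x = 0) \<and>
     (\<forall>c x. \<gamma> (c *\<^sub>R x) = \<bar>c\<bar> * \<gamma> x) \<and>
     (\<forall>x y. \<gamma> (x + y) \<le> \<gamma> x + \<gamma> y)"

definition birkhoff_orth :: "('a::real_vector \<Rightarrow> real) \<Rightarrow> real \<Rightarrow> 'a \<Rightarrow> 'a \<Rightarrow> bool" where
  "birkhoff_orth \<gamma> \<epsilon> x y \<longleftrightarrow> (\<forall>c. \<gamma> x \<le> \<gamma> (x + c *\<^sub>R y) + \<epsilon>)"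

end

theory Submission
  imports Defs
begin

text \<open>For \<open>\<epsilon> > 0\<close>, every \<open>x\<close> with \<open>\<gamma> x \<le> \<epsilon>\<close> is orthogonal to everything, so by symmetry every vector
  is orthogonal to such an \<open>x \<noteq> 0\<close>; for large multiples of \<open>x\<close> this is absurd.  For \<open>\<epsilon> = 0\<close>, the
  relation is insensitive to the sign of its right argument, hence by symmetry also of its left
  one: the unit ball has parallel supporting lines at opposite boundary points.  On a line missing
  the origin this says that \<open>\<gamma>\<close> and its reflection have the same logarithmic subgradients, so their
  ratio \<open>\<gamma> (- x) / \<gamma> x\<close> is constant along the line.  Joining \<open>x\<close> to \<open>- x\<close> by two such lines shows
  that the ratio equals its own inverse.\<close>

section \<open>Elementary facts on gauges and on signs in orthogonality\<close>

lemma gauge_zero: "is_gauge \<gamma> \<Longrightarrow> \<gamma> 0 = 0"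
proof -
  assume "is_gauge \<gamma>"
  then have "\<gamma> (2 *\<^sub>R 0) = 2 * \<gamma> 0"
    unfolding is_gauge_def by (metis zero_less_numeral)
  then show ?thesis by simp
qed

lemma gauge_nonneg: "is_gauge \<gamma> \<Longrightarrow> \<gamma> x \<ge> 0"
  by (simp add: is_gauge_def)

lemma gauge_pos:
  assumes "is_gauge \<gamma>" and "x \<noteq> 0"
  shows "\<gamma> x > 0"
proof -
  have "\<gamma> x \<noteq> 0" using assms unfolding is_gauge_def by blast
  then show ?thesis using gauge_nonneg[OF assms(1), of x] by linarith
qed

lemma gauge_scale:
  assumes "is_gauge \<gamma>" and "c \<ge> 0"
  shows "\<gamma> (c *\<^sub>R x) = c * \<gamma> x"
proof (cases "c = 0")
  case True
  then show ?thesis using gauge_zero[OF assms(1)] by simp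
next
  case False
  then have "c > 0" using assms(2) by simp
  then show ?thesis using assms(1) unfolding is_gauge_def by blast
qed

lemma gauge_triangle: "is_gauge \<gamma> \<Longrightarrow> \<gamma> (x + y) \<le> \<gamma> x + \<gamma> y"
  by (simp add: is_gauge_def)

lemma gauge_convex_on_line:
  assumes "is_gauge \<gamma>"
  shows "convex_on UNIV (\<lambda>t::real. \<gamma> (x + t *\<^sub>R d))"
proof (rule convex_onI)
  fix u s t :: real
  assume u: "0 < u" "u < 1"
  have "x + ((1 - u) *\<^sub>R s + u *\<^sub>R t) *\<^sub>R d = (1 - u) *\<^sub>R (x + s *\<^sub>R d) + u *\<^sub>R (x + t *\<^sub>R d)"
    by (simp add: algebra_simps)
  then show "\<gamma> (x + ((1 - u) *\<^sub>R s + u *\<^sub>R t) *\<^sub>R d)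
      \<le> (1 - u) * \<gamma> (x + s *\<^sub>R d) + u * \<gamma> (x + t *\<^sub>R d)"
    using gauge_triangle[OF assms, of "(1 - u) *\<^sub>R (x + s *\<^sub>R d)" "u *\<^sub>R (x + t *\<^sub>R d)"] u
    by (simp add: gauge_scale[OF assms])
qed simp

lemma birkhoff_orth_minus_right: "birkhoff_orth \<gamma> \<epsilon> x (- y) \<longleftrightarrow> birkhoff_orth \<gamma> \<epsilon> x y"
proof -
  have "birkhoff_orth \<gamma> \<epsilon> x (- y)" if "birkhoff_orth \<gamma> \<epsilon> x y" for y
    using that unfolding birkhoff_orth_def by (metis scaleR_minus_left scaleR_minus_right)
  from this[of y] this[of "- y"] show ?thesis by auto
qed

lemma birkhoff_orth_minus_left:
  assumes "\<forall>x y. birkhoff_orth \<gamma> \<epsilon> x y \<longrightarrow> birkhoff_orth \<gamma> \<epsilon> y x"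
    and "birkhoff_orth \<gamma> \<epsilon> x y"
  shows "birkhoff_orth \<gamma> \<epsilon> (- x) y"
proof -
  have "birkhoff_orth \<gamma> \<epsilon> y (- x)"
    using assms birkhoff_orth_minus_right[of \<gamma> \<epsilon> y x] by blast
  then show ?thesis using assms(1) by blast
qed

section \<open>Vanishing of the tolerance\<close>

lemma symmetric_birkhoff_orth_imp_zero:
  fixes \<gamma> :: "'a::real_vector \<Rightarrow> real" and v :: 'a
  assumes gauge: "is_gauge \<gamma>" and "\<epsilon> \<ge> 0"
    and sym: "\<forall>x y. birkhoff_orth \<gamma> \<epsilon> x y \<longrightarrow> birkhoff_orth \<gamma> \<epsilon> y x"
    and "v \<noteq> 0"
  shows "\<epsilon> = 0"
proof (rule ccontr)
  assume "\<epsilon> \<noteq> 0"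
  then have "\<epsilon> > 0" using assms by simp
  \<comment> \<open>This scaling makes \<open>\<gamma> y\<close> twice \<open>\<epsilon>\<close>:
    half of \<open>y\<close> is small enough to be orthogonal to everything, whereas cancelling
    \<open>y\<close> completely would violate the reversed relation.\<close>
  define y where "y = (2 * \<epsilon> / \<gamma> v) *\<^sub>R v"
  have "\<gamma> v > 0" using gauge_pos[OF gauge \<open>v \<noteq> 0\<close>] .
  then have y: "\<gamma> y = 2 * \<epsilon>"
    using \<open>\<epsilon> > 0\<close> by (simp add: y_def gauge_scale[OF gauge])
  have "\<gamma> ((1 / 2) *\<^sub>R y) = \<epsilon>"
    using y by (simp add: gauge_scale[OF gauge])
  then have "birkhoff_orth \<gamma> \<epsilon> ((1 / 2) *\<^sub>R y) y"
    unfolding birkhoff_orth_def using gauge_nonneg[OF gauge] by simp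
  then have "birkhoff_orth \<gamma> \<epsilon> y ((1 / 2) *\<^sub>R y)"
    using sym by blast
  then have "\<gamma> y \<le> \<gamma> (y + (- 2) *\<^sub>R ((1 / 2) *\<^sub>R y)) + \<epsilon>"
    unfolding birkhoff_orth_def by blast
  then show False using y \<open>\<epsilon> > 0\<close> gauge_zero[OF gauge] by simp
qed

section \<open>Logarithmic subgradients along a line\<close>

text \<open>For independent \<open>z\<close> and \<open>d\<close>, let f be the linear functional on
  their span with f(z) = \<open>\<gamma> z\<close> and f(d) = \<open>q * \<gamma> z\<close>. The
  hypothesis is f <= \<open>\<gamma>\<close> on the line through \<open>z\<close> in direction
  \<open>d\<close>, and f is constant along \<open>d - q *\<^sub>R z\<close>. Homogeneity and
  convexity carry the bound over to that direction.\<close>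

lemma birkhoff_orth_if_subgradient:
  assumes gauge: "is_gauge \<gamma>"
    and subgrad: "\<And>s. \<gamma> (z + s *\<^sub>R d) \<ge> \<gamma> z * (1 + s * q)"
  shows "birkhoff_orth \<gamma> 0 z (d - q *\<^sub>R z)"
  unfolding birkhoff_orth_def
proof
  fix c :: real
  let ?w = "d - q *\<^sub>R z"
  \<comment> \<open>The point \<open>z + c *\<^sub>R ?w\<close> need not be a positive multiple of a
    point of the given line. Going only the fraction \<open>\<theta>\<close> of the way ensures
    this, and convexity covers the rest.\<close>
  define \<theta> where "\<theta> = 1 / (1 + \<bar>c * q\<bar>)"
  have \<theta>: "0 < \<theta>" "\<theta> \<le> 1" by (auto simp: \<theta>_def)
  have "\<theta> * (c * q) \<le> \<theta> * \<bar>c * q\<bar>" using \<theta> by (intro mult_left_mono) auto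
  also have "\<dots> < 1" by (simp add: \<theta>_def)
  finally have pos: "1 - \<theta> * c * q > 0" by (simp add: mult.assoc)
  let ?m = "1 - \<theta> * c * q"
  let ?s = "\<theta> * c / ?m"
  have "z + (\<theta> * c) *\<^sub>R ?w = ?m *\<^sub>R (z + ?s *\<^sub>R d)"
    using pos by (simp add: scaleR_add_right) (simp add: algebra_simps)
  then have "\<gamma> (z + (\<theta> * c) *\<^sub>R ?w) = ?m * \<gamma> (z + ?s *\<^sub>R d)"
    using pos by (simp add: gauge_scale[OF gauge])
  moreover have "?m * \<gamma> (z + ?s *\<^sub>R d) \<ge> ?m * (\<gamma> z * (1 + ?s * q))"
    using pos by (intro mult_left_mono subgrad) simp
  moreover have "?m * (\<gamma> z * (1 + ?s * q)) = \<gamma> z"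
    using pos by (simp add: field_simps)
  ultimately have "\<gamma> z \<le> \<gamma> (z + (\<theta> * c) *\<^sub>R ?w)" by linarith
  also have "z + (\<theta> * c) *\<^sub>R ?w = (1 - \<theta>) *\<^sub>R z + \<theta> *\<^sub>R (z + c *\<^sub>R ?w)"
    by (simp add: algebra_simps)
  also have "\<gamma> \<dots> \<le> (1 - \<theta>) * \<gamma> z + \<theta> * \<gamma> (z + c *\<^sub>R ?w)"
    using gauge_triangle[OF gauge, of "(1 - \<theta>) *\<^sub>R z" "\<theta> *\<^sub>R (z + c *\<^sub>R ?w)"] \<theta>
    by (simp add: gauge_scale[OF gauge])
  finally have "\<theta> * \<gamma> z \<le> \<theta> * \<gamma> (z + c *\<^sub>R ?w)" by (simp add: algebra_simps)
  then show "\<gamma> z \<le> \<gamma> (z + c *\<^sub>R ?w) + 0" using \<theta> by simp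
qed

text \<open>The converse: dividing \<open>z + s *\<^sub>R d\<close> by \<open>1 + s * q\<close>
  moves it onto the line through \<open>z\<close> in direction \<open>d - q *\<^sub>R z\<close>; if
  that factor is not positive, the bound is trivial.\<close>

lemma subgradient_if_birkhoff_orth:
  assumes gauge: "is_gauge \<gamma>"
    and orth: "birkhoff_orth \<gamma> 0 z (d - q *\<^sub>R z)"
  shows "\<gamma> (z + s *\<^sub>R d) \<ge> \<gamma> z * (1 + s * q)"
proof (cases "1 + s * q > 0")
  case True
  let ?m = "1 + s * q"
  have "z + s *\<^sub>R d = ?m *\<^sub>R (z + (s / ?m) *\<^sub>R (d - q *\<^sub>R z))"
    using True by (simp add: scaleR_add_right) (simp add: algebra_simps)
  then have "\<gamma> (z + s *\<^sub>R d) = ?m * \<gamma> (z + (s / ?m) *\<^sub>R (d - q *\<^sub>R z))"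
    using True by (simp add: gauge_scale[OF gauge])
  also have "\<dots> \<ge> ?m * \<gamma> z"
    using orth True unfolding birkhoff_orth_def by (intro mult_left_mono) auto
  finally show ?thesis by (simp add: mult.commute)
next
  case False
  then have "\<gamma> z * (1 + s * q) \<le> 0"
    using gauge_nonneg[OF gauge, of z] by (simp add: mult_nonneg_nonpos)
  then show ?thesis using gauge_nonneg[OF gauge, of "z + s *\<^sub>R d"] by linarith
qed

text \<open>Along a uniform partition of \<open>[0, 1]\<close> into \<open>n\<close> steps, the first-order terms of the
  increments of \<open>ln h - ln g\<close> telescope to \<open>(q 0 - q 1) / n\<close>, and the errors add up to \<open>O(1 / n)\<close>;
  so no regularity of \<open>q\<close> beyond boundedness is needed.\<close>

lemma ratio_mono_if_common_log_subgradient: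
  fixes g h q :: "real \<Rightarrow> real"
  assumes pos: "\<And>t. t \<in> {0..1} \<Longrightarrow> g t > 0" "\<And>t. t \<in> {0..1} \<Longrightarrow> h t > 0"
    and g: "\<And>s t. s \<in> {0..1} \<Longrightarrow> t \<in> {0..1} \<Longrightarrow> g s \<ge> g t * (1 + (s - t) * q t)"
    and h: "\<And>s t. s \<in> {0..1} \<Longrightarrow> t \<in> {0..1} \<Longrightarrow> h s \<ge> h t * (1 + (s - t) * q t)"
    and M: "\<And>t. t \<in> {0..1} \<Longrightarrow> \<bar>q t\<bar> \<le> M"
  shows "h 0 / g 0 \<le> h 1 / g 1"
proof -
  define L where "L t = ln (h t) - ln (g t)" for t
  have ln_incr: "ln (f s) - ln (f t) \<ge> (s - t) * q t - 2 * ((s - t) * M)\<^sup>2"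
    if f: "f s > 0" "f t > 0" "f s \<ge> f t * (1 + (s - t) * q t)"
      and t: "t \<in> {0..1}" and small: "\<bar>s - t\<bar> * M \<le> 1 / 2" for f :: "real \<Rightarrow> real" and s t
  proof -
    let ?x = "(s - t) * q t"
    have x: "\<bar>?x\<bar> \<le> \<bar>s - t\<bar> * M"
      using M[OF t] by (simp add: abs_mult mult_left_mono)
    then have x2: "\<bar>?x\<bar> \<le> 1 / 2" using small by linarith
    have "?x\<^sup>2 \<le> (\<bar>s - t\<bar> * M)\<^sup>2"
      using power_mono[OF x, of 2] by simp
    then have "?x\<^sup>2 \<le> ((s - t) * M)\<^sup>2" by (simp add: power_mult_distrib)
    moreover have "\<bar>ln (1 + ?x) - ?x\<bar> \<le> 2 * ?x\<^sup>2"
      using abs_ln_one_plus_x_minus_x_bound[OF x2] .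
    ultimately have "ln (1 + ?x) \<ge> ?x - 2 * ((s - t) * M)\<^sup>2" by linarith
    moreover have "1 + ?x > 0" using x2 by (simp add: abs_le_iff)
    then have "ln (f t) + ln (1 + ?x) = ln (f t * (1 + ?x))"
      using f by (simp add: ln_mult)
    moreover have "\<dots> \<le> ln (f s)"
      using f \<open>1 + ?x > 0\<close> by (subst ln_le_cancel_iff) auto
    ultimately show ?thesis by linarith
  qed
  have main: "L 1 - L 0 \<ge> (q 0 - q 1 - 4 * M\<^sup>2) / real n" if n: "n > 0" "real n \<ge> 2 * M" for n
  proof -
    let ?t = "\<lambda>i. real i / real n"
    have "L (?t (Suc i)) - L (?t i) \<ge> (q (?t i) - q (?t (Suc i))) / n - 4 * (M / n)\<^sup>2"
      if "i < n" for i
    proof -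
      have I: "?t i \<in> {0..1}" "?t (Suc i) \<in> {0..1}" using that by auto
      have d: "?t (Suc i) - ?t i = 1 / n" "?t i - ?t (Suc i) = - (1 / n)"
        by (simp_all add: diff_divide_distrib[symmetric])
      have "1 / n * M \<le> 1 / 2" using n by (simp add: field_simps)
      then have small: "\<bar>?t (Suc i) - ?t i\<bar> * M \<le> 1 / 2" "\<bar>?t i - ?t (Suc i)\<bar> * M \<le> 1 / 2"
        unfolding d by auto
      \<comment> \<open>Subgradients bound increments only from below, so \<open>ln h\<close> is
        expanded at the left node going right and \<open>ln g\<close> at the right node going left.
        Hence \<open>q\<close> appears at both nodes with opposite signs.\<close>
      from ln_incr[OF pos(2)[OF I(2)] pos(2)[OF I(1)] h[OF I(2) I(1)] I(1) small(1)]
        ln_incr[OF pos(1)[OF I(1)] pos(1)[OF I(2)] g[OF I(1) I(2)] I(2) small(2)]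
      show ?thesis unfolding L_def d by (simp add: diff_divide_distrib)
    qed
    then have "(\<Sum>i<n. (q (?t i) - q (?t (Suc i))) / n - 4 * (M / n)\<^sup>2)
        \<le> (\<Sum>i<n. L (?t (Suc i)) - L (?t i))"
      by (intro sum_mono) auto
    also have "\<dots> = L 1 - L 0"
      using n sum_lessThan_telescope[of "\<lambda>i. L (?t i)" n] by simp
    also have "(\<Sum>i<n. (q (?t i) - q (?t (Suc i))) / n - 4 * (M / n)\<^sup>2)
        = (q 0 - q 1) / n - n * (4 * (M / n)\<^sup>2)"
      using n sum_lessThan_telescope'[of "\<lambda>i. q (?t i)" n]
      by (simp add: sum_subtractf sum_divide_distrib[symmetric])
    also have "\<dots> = (q 0 - q 1 - 4 * M\<^sup>2) / n"
      using n by (simp add: field_simps power2_eq_square)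
    finally show ?thesis .
  qed
  have "(\<lambda>n. (q 0 - q 1 - 4 * M\<^sup>2) / real n) \<longlonglongrightarrow> 0"
    by (rule lim_const_over_n)
  moreover have "\<forall>\<^sub>F n in sequentially. (q 0 - q 1 - 4 * M\<^sup>2) / real n \<le> L 1 - L 0"
  proof -
    obtain N where "2 * M \<le> real N" using real_arch_simple by blast
    then show ?thesis
      using main by (intro eventually_sequentiallyI[of "Suc N"]) auto
  qed
  ultimately have "0 \<le> L 1 - L 0"
    by (rule tendsto_upperbound) simp
  then have "ln (h 0 / g 0) \<le> ln (h 1 / g 1)"
    using pos[of 0] pos[of 1] by (simp add: L_def ln_div)
  then show ?thesis
    using pos[of 0] pos[of 1] by simp
qed

text \<open>An inequality suffices, since \<open>x\<close> and \<open>y\<close> can be exchanged. A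
  subgradient of \<open>\<gamma>\<close> at a point of the line becomes an orthogonality, which
  survives reflecting the point and then turns back into a subgradient with the same
  \<open>q\<close>.\<close>

lemma gauge_reflection_ratio_le:
  fixes \<gamma> :: "'a::real_vector \<Rightarrow> real"
  assumes gauge: "is_gauge \<gamma>"
    and sym: "\<forall>x y. birkhoff_orth \<gamma> 0 x y \<longrightarrow> birkhoff_orth \<gamma> 0 y x"
    and nz: "\<And>t::real. x + t *\<^sub>R (y - x) \<noteq> 0"
  shows "\<gamma> (- x) / \<gamma> x \<le> \<gamma> (- y) / \<gamma> y"
proof -
  define d where "d = y - x"
  define z where "z t = x + t *\<^sub>R d" for t :: real
  define g where "g t = \<gamma> (z t)" for t
  define h where "h t = \<gamma> (- z t)" for t
  have z_add: "z s = z t + (s - t) *\<^sub>R d" for s t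
    by (simp add: z_def algebra_simps)
  have pos: "g t > 0" "h t > 0" for t
    using gauge_pos[OF gauge, of "z t"] gauge_pos[OF gauge, of "- z t"] nz[of t]
    unfolding g_def h_def z_def d_def neg_equal_0_iff_equal by blast+
  have conv: "convex_on UNIV g"
    unfolding g_def z_def by (rule gauge_convex_on_line[OF gauge])
  have "\<exists>p. \<forall>s. g s \<ge> g t * (1 + (s - t) * p)" for t
  proof -
    \<comment> \<open>This is the right derivative of \<open>g\<close> at \<open>t\<close>; dividing
      it by \<open>g t\<close> gives the logarithmic form.\<close>
    define p where "p = Inf ((\<lambda>s. (g t - g s) / (t - s)) ` ({t<..} \<inter> UNIV))"
    have "g s \<ge> g t + p * (s - t)" for s
      unfolding p_def by (rule convex_le_Inf_differential[OF conv]) simp_all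
    moreover have "g t * (1 + (s - t) * (p / g t)) = g t + p * (s - t)" for s
      using pos(1)[of t] by (simp add: field_simps)
    ultimately have "g s \<ge> g t * (1 + (s - t) * (p / g t))" for s by simp
    then show ?thesis by blast
  qed
  then obtain q where q: "\<And>s t. g s \<ge> g t * (1 + (s - t) * q t)" by metis
  have h: "h s \<ge> h t * (1 + (s - t) * q t)" for s t
  proof -
    have "\<gamma> (z t + r *\<^sub>R d) \<ge> \<gamma> (z t) * (1 + r * q t)" for r
      using q[of t "t + r"] z_add[of "t + r" t] by (simp add: g_def)
    then have "birkhoff_orth \<gamma> 0 (z t) (d - q t *\<^sub>R z t)"
      by (rule birkhoff_orth_if_subgradient[OF gauge])
    then have "birkhoff_orth \<gamma> 0 (- z t) (d - q t *\<^sub>R z t)"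
      by (rule birkhoff_orth_minus_left[OF sym])
    \<comment> \<open>As \<open>t\<close> grows, \<open>- z t\<close> moves in direction
      \<open>- d\<close>, so the right argument changes sign too.\<close>
    then have "birkhoff_orth \<gamma> 0 (- z t) (- d - q t *\<^sub>R (- z t))"
      using birkhoff_orth_minus_right[of \<gamma> 0 "- z t" "d - q t *\<^sub>R z t"] by simp
    from subgradient_if_birkhoff_orth[OF gauge this, of "s - t"]
    show ?thesis using z_add[of s t] by (simp add: h_def)
  qed
  have cont: "continuous_on UNIV g"
    by (rule convex_on_continuous[OF open_UNIV conv])
  obtain a where a: "\<And>t. t \<in> {0..1} \<Longrightarrow> g a \<le> g t"
    using continuous_attains_inf[of "{0..1::real}" g] continuous_on_subset[OF cont subset_UNIV]
    by (auto simp: Ball_def)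
  \<comment> \<open>The interval is enlarged by 1 on both sides because \<open>q t\<close> is
    bounded by testing the subgradient inequality at \<open>t + 1\<close> and
    \<open>t - 1\<close>.\<close>
  obtain b where b: "\<And>t. t \<in> {-1..2} \<Longrightarrow> g t \<le> g b"
    using continuous_attains_sup[of "{-1..2::real}" g] continuous_on_subset[OF cont subset_UNIV]
    by (auto simp: Ball_def)
  have "\<bar>q t\<bar> \<le> g b / g a" if t: "t \<in> {0..1}" for t
  proof -
    have "g t * (1 + q t) \<le> g b" "g t * (1 - q t) \<le> g b"
      using q[of t "t + 1"] b[of "t + 1"] q[of t "t - 1"] b[of "t - 1"] t by auto
    then have "g t * \<bar>q t\<bar> \<le> g b"
      using pos(1)[of t] by (auto simp: abs_if algebra_simps)
    moreover have "g a * \<bar>q t\<bar> \<le> g t * \<bar>q t\<bar>"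
      using a[OF t] by (intro mult_right_mono) auto
    ultimately show ?thesis using pos(1)[of a] by (simp add: field_simps)
  qed
  then have "h 0 / g 0 \<le> h 1 / g 1"
    by (intro ratio_mono_if_common_log_subgradient[of g h q "g b / g a"] pos q h)
  then show ?thesis by (simp add: g_def h_def z_def d_def)
qed

section \<open>Evenness of the gauge\<close>

lemma line_avoids_zero:
  fixes x y :: "'a::real_vector"
  assumes "x \<noteq> 0" and "y \<notin> span {x}"
  shows "x + t *\<^sub>R (y - x) \<noteq> 0"
proof
  assume "x + t *\<^sub>R (y - x) = 0"
  then have *: "t *\<^sub>R y = (t - 1) *\<^sub>R x" by (simp add: algebra_simps add_eq_0_iff)
  show False
  proof (cases "t = 0")
    case True
    then show False using * assms by simp
  next
    case False
    then have "y = (1 / t) *\<^sub>R (t *\<^sub>R y)" by simp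
    also have "\<dots> = ((t - 1) / t) *\<^sub>R x" unfolding * by simp
    finally show False using assms(2) by (metis span_base span_scale singletonI)
  qed
qed

text \<open>The line from \<open>x\<close> to \<open>- x\<close> passes through the origin, where
  the ratio argument breaks down; \<open>y\<close> provides a detour.\<close>

lemma symmetric_birkhoff_orth_imp_even:
  fixes \<gamma> :: "'a::real_vector \<Rightarrow> real"
  assumes gauge: "is_gauge \<gamma>"
    and sym: "\<forall>x y. birkhoff_orth \<gamma> 0 x y \<longrightarrow> birkhoff_orth \<gamma> 0 y x"
    and x: "x \<noteq> 0" and y: "y \<notin> span {x}"
  shows "\<gamma> (- x) = \<gamma> x"
proof -
  let ?R = "\<lambda>v. \<gamma> (- v) / \<gamma> v"
  have le: "?R u \<le> ?R v" if "\<And>t::real. u + t *\<^sub>R (v - u) \<noteq> 0" for u v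
    using gauge_reflection_ratio_le[OF gauge sym that] .
  have rev: "v + t *\<^sub>R (u - v) \<noteq> 0" if "\<And>t::real. u + t *\<^sub>R (v - u) \<noteq> 0" for u v :: 'a and t
    using that[of "1 - t"] by (simp add: algebra_simps)
  have xy: "x + t *\<^sub>R (y - x) \<noteq> 0" for t
    by (rule line_avoids_zero[OF x y])
  have y': "y \<notin> span {- x}" 
  proof -
    have "span {- x} \<subseteq> span {x}"
      by (rule span_minimal) (simp_all add: span_neg span_base)
    then show ?thesis using y by blast
  qed
  have mxy: "- x + t *\<^sub>R (y - - x) \<noteq> 0" for t
    using line_avoids_zero[of "- x" y t] x y' by simp
  have "?R x = ?R y" "?R (- x) = ?R y"
    using le[OF xy] le[OF rev[OF xy]] le[OF mxy] le[OF rev[OF mxy]] by linarith+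
  then have "\<gamma> (- x) / \<gamma> x = \<gamma> x / \<gamma> (- x)" by simp
  moreover have "\<gamma> x > 0" "\<gamma> (- x) > 0" using gauge_pos[OF gauge] x by auto
  ultimately have "(\<gamma> (- x))\<^sup>2 = (\<gamma> x)\<^sup>2" by (simp add: field_simps power2_eq_square)
  then show ?thesis using gauge_nonneg[OF gauge] by simp
qed

lemma is_norm_if_even_gauge:
  assumes gauge: "is_gauge \<gamma>" and even: "\<And>x. \<gamma> (- x) = \<gamma> x"
  shows "is_norm \<gamma>"
proof -
  have "\<gamma> (c *\<^sub>R x) = \<bar>c\<bar> * \<gamma> x" for c x
    using gauge_scale[OF gauge, of "\<bar>c\<bar>" x] even[of "c *\<^sub>R x"] by (cases "c \<ge> 0") auto
  then show ?thesis
    using gauge gauge_zero[OF gauge] unfolding is_norm_def is_gauge_def by blast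
qed

theorem corollary3p25:
  fixes \<gamma> :: "real ^ 'd \<Rightarrow> real" and \<epsilon> :: real
  assumes "CARD('d) \<ge> 2"
    and "is_gauge \<gamma>"
    and "\<epsilon> \<ge> 0"
    and "\<forall>x y. birkhoff_orth \<gamma> \<epsilon> x y \<longrightarrow> birkhoff_orth \<gamma> \<epsilon> y x"
  shows "\<epsilon> = 0 \<and> is_norm \<gamma>"
proof -
  have "axis undefined 1 \<noteq> (0 :: real ^ 'd)" by (simp add: axis_eq_0_iff)
  then have \<epsilon>: "\<epsilon> = 0"
    using symmetric_birkhoff_orth_imp_zero assms(2-4) by blast
  have "\<gamma> (- x) = \<gamma> x" for x
  proof (cases "x = 0")
    case False
    \<comment> \<open>Here the dimension matters: in dimension one,
      \<open>birkhoff_orth \<gamma> 0 x y\<close> just means that \<open>x\<close> or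
      \<open>y\<close> vanishes, which is symmetric for every gauge.\<close>
    have "dim (span {x}) < dim (UNIV :: (real ^ 'd) set)"
      using dim_le_card[of "{x}" "{x}"] assms(1) by (simp add: span_base)
    then obtain y where "y \<notin> span {x}" by (metis UNIV_eq_I less_irrefl)
    then show ?thesis
      using symmetric_birkhoff_orth_imp_even[OF assms(2)] assms(4) \<epsilon> False by blast
  qed simp
  then show ?thesis using \<epsilon> is_norm_if_even_gauge[OF assms(2)] by blast
qed

end
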